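(* Let $X$ and $Y$ be Banach spaces. If $X$ is reflexive and the pair $(X,Y)$ has both property $(m)$ and property $(o)$, then $(X,Y)$ has the weak minimizing property.
   Context: $\mathcal{L}(X,Y)$ denotes the space of bounded linear operators from $X$ to $Y$, and $S_X$ the unit sphere of $X$. The minimum modulus of $T\in\mathcal{L}(X,Y)$ is $m(T)=\inf\{\|Tx\|:x\in S_X\}$; $T$ attains its minimum modulus if $\|Tx\|=m(T)$ for some $x\in S_X$. A minimizing sequence for $T$ is a sequence $(x_n)_n$ in $S_X$ with $\|Tx_n\|\to m(T)$. The pair $(X,Y)$ has the weak minimizing property (WmP) if every $T\in\mathcal{L}(X,Y)$ that admits a non-weakly null minimizing sequence (i.e. one that does not converge weakly to $0$) attains its minimum modulus. An operator $T\in\mathcal{L}(X,Y)$ satisfies property $(m)$ if for all $x\in X$, $y\in Y$ with $\|x\|\le\|y\|$ and every weakly null sequence $(x_n)_n$ in $X$, $\limsup_n\|x+x_n\|\le\limsup_n\|y+Tx_n\|$. The pair $(X,Y)$ satisfies property $(m)$ if every $T\in\mathcal{L}(X,Y)$ with $m(T)\ge 1$ satisfies property $(m)$. An operator $T\in\mathcal{L}(X,Y)$ satisfies property $(o)$ if for every nonzero $y\in Y$ and every weakly null sequence $(x_n)_n$ in $X$, $\limsup_n\|x_n\|<\limsup_n\|y+Tx_n\|$. The pair $(X,Y)$ satisfies property $(o)$ if every $T\in\mathcal{L}(X,Y)$ with $m(T)\ge 1$ satisfies property $(o)$. *)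

theory Defs
  imports "HOL-Analysis.Analysis"
begin

text \<open>
  The scalar field is an arbitrary type of sort \<open>{real_normed_field, euclidean_space}\<close>, i.e. a
  finite-dimensional real normed field. By Frobenius' theorem such a field is isomorphic to the
  reals or the complex numbers, so real and complex Banach spaces are treated at once. A Banach
  space over \<open>'k\<close> is a type of class \<^class>\<open>banach\<close> with a scalar multiplication \<open>scale\<close> by elements
  of \<open>'k\<close> that extends the real one and is compatible with the norm.
\<close>

locale normed_space_over = vector_space scale
  for scale :: "'k::{real_normed_field,euclidean_space} \<Rightarrow> 'a::real_normed_vector \<Rightarrow> 'a" +
  assumes norm_scale: "norm (scale c x) = norm c * norm x"
    and scale_of_real: "scale (of_real r) x = r *\<^sub>R x"

lemma normed_space_over_scaleR:
  "normed_space_over ((*\<^sub>R) :: real \<Rightarrow> 'a::real_normed_vector \<Rightarrow> 'a)"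
  by unfold_locales (auto simp: algebra_simps)

lemma normed_space_over_field:
  "normed_space_over ((*) :: 'k::{real_normed_field,euclidean_space} \<Rightarrow> 'k \<Rightarrow> 'k)"
  by unfold_locales (auto simp: algebra_simps norm_mult scaleR_conv_of_real)

definition bounded_operators ::
  "('k::{real_normed_field,euclidean_space} \<Rightarrow> 'a::real_normed_vector \<Rightarrow> 'a) \<Rightarrow>
   ('k \<Rightarrow> 'b::real_normed_vector \<Rightarrow> 'b) \<Rightarrow> ('a \<Rightarrow> 'b) set" where
  "bounded_operators sX sY =
     {T. Vector_Spaces.linear sX sY T \<and> (\<exists>B. \<forall>x. norm (T x) \<le> B * norm x)}"

definition dual_space ::
  "('k::{real_normed_field,euclidean_space} \<Rightarrow> 'a::real_normed_vector \<Rightarrow> 'a) \<Rightarrow> ('a \<Rightarrow> 'k) set" where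
  "dual_space sX = bounded_operators sX (*)"

text \<open>
  Elements of the bidual are represented by functions on all of \<open>'a \<Rightarrow> 'k\<close>, of which only the values
  on the dual space matter; linearity, boundedness (for the dual norm \<^const>\<open>onorm\<close>) and equality are
  therefore relativised to the dual space.
\<close>

definition bounded_functional_on_dual ::
  "('k::{real_normed_field,euclidean_space} \<Rightarrow> 'a::real_normed_vector \<Rightarrow> 'a) \<Rightarrow>
   (('a \<Rightarrow> 'k) \<Rightarrow> 'k) \<Rightarrow> bool" where
  "bounded_functional_on_dual sX \<Phi> \<longleftrightarrow>
     (\<forall>f\<in>dual_space sX. \<forall>g\<in>dual_space sX. \<Phi> (\<lambda>x. f x + g x) = \<Phi> f + \<Phi> g) \<and>
     (\<forall>c. \<forall>f\<in>dual_space sX. \<Phi> (\<lambda>x. c * f x) = c * \<Phi> f) \<and>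
     (\<exists>B. \<forall>f\<in>dual_space sX. norm (\<Phi> f) \<le> B * onorm f)"

definition reflexive_space ::
  "('k::{real_normed_field,euclidean_space} \<Rightarrow> 'a::real_normed_vector \<Rightarrow> 'a) \<Rightarrow> bool" where
  "reflexive_space sX \<longleftrightarrow>
     (\<forall>\<Phi>. bounded_functional_on_dual sX \<Phi> \<longrightarrow> (\<exists>x. \<forall>f\<in>dual_space sX. \<Phi> f = f x))"

definition weakly_converges_to ::
  "('k::{real_normed_field,euclidean_space} \<Rightarrow> 'a::real_normed_vector \<Rightarrow> 'a) \<Rightarrow>
   (nat \<Rightarrow> 'a) \<Rightarrow> 'a \<Rightarrow> bool" where
  "weakly_converges_to sX u l \<longleftrightarrow> (\<forall>f\<in>dual_space sX. (\<lambda>n. f (u n)) \<longlonglongrightarrow> f l)"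

definition weakly_null ::
  "('k::{real_normed_field,euclidean_space} \<Rightarrow> 'a::real_normed_vector \<Rightarrow> 'a) \<Rightarrow>
   (nat \<Rightarrow> 'a) \<Rightarrow> bool" where
  "weakly_null sX u \<longleftrightarrow> weakly_converges_to sX u 0"

text \<open>
  If the domain is the zero space, its unit sphere is empty and the value of \<open>min_modulus\<close> is an
  unspecified real number. The weak minimizing property is then vacuously true.
\<close>

definition min_modulus :: "('a::real_normed_vector \<Rightarrow> 'b::real_normed_vector) \<Rightarrow> real" where
  "min_modulus T = (INF x\<in>sphere 0 1. norm (T x))"

definition attains_min_modulus :: "('a::real_normed_vector \<Rightarrow> 'b::real_normed_vector) \<Rightarrow> bool" where
  "attains_min_modulus T \<longleftrightarrow> (\<exists>x\<in>sphere 0 1. norm (T x) = min_modulus T)"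

definition minimizing_sequence ::
  "('a::real_normed_vector \<Rightarrow> 'b::real_normed_vector) \<Rightarrow> (nat \<Rightarrow> 'a) \<Rightarrow> bool" where
  "minimizing_sequence T u \<longleftrightarrow>
     (\<forall>n. u n \<in> sphere 0 1) \<and> (\<lambda>n. norm (T (u n))) \<longlonglongrightarrow> min_modulus T"

definition weak_minimizing_property ::
  "('k::{real_normed_field,euclidean_space} \<Rightarrow> 'a::real_normed_vector \<Rightarrow> 'a) \<Rightarrow>
   ('k \<Rightarrow> 'b::real_normed_vector \<Rightarrow> 'b) \<Rightarrow> bool" where
  "weak_minimizing_property sX sY \<longleftrightarrow>
     (\<forall>T\<in>bounded_operators sX sY.
        (\<exists>u. minimizing_sequence T u \<and> \<not> weakly_null sX u) \<longrightarrow> attains_min_modulus T)"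

definition operator_property_m ::
  "('k::{real_normed_field,euclidean_space} \<Rightarrow> 'a::real_normed_vector \<Rightarrow> 'a) \<Rightarrow>
   ('a \<Rightarrow> 'b::real_normed_vector) \<Rightarrow> bool" where
  "operator_property_m sX T \<longleftrightarrow>
     (\<forall>x y u. norm x \<le> norm y \<longrightarrow> weakly_null sX u \<longrightarrow>
        limsup (\<lambda>n. ereal (norm (x + u n))) \<le> limsup (\<lambda>n. ereal (norm (y + T (u n)))))"

definition property_m ::
  "('k::{real_normed_field,euclidean_space} \<Rightarrow> 'a::real_normed_vector \<Rightarrow> 'a) \<Rightarrow>
   ('k \<Rightarrow> 'b::real_normed_vector \<Rightarrow> 'b) \<Rightarrow> bool" where
  "property_m sX sY \<longleftrightarrow>
     (\<forall>T\<in>bounded_operators sX sY. min_modulus T \<ge> 1 \<longrightarrow> operator_property_m sX T)"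

definition operator_property_o ::
  "('k::{real_normed_field,euclidean_space} \<Rightarrow> 'a::real_normed_vector \<Rightarrow> 'a) \<Rightarrow>
   ('a \<Rightarrow> 'b::real_normed_vector) \<Rightarrow> bool" where
  "operator_property_o sX T \<longleftrightarrow>
     (\<forall>y u. y \<noteq> 0 \<longrightarrow> weakly_null sX u \<longrightarrow>
        limsup (\<lambda>n. ereal (norm (u n))) < limsup (\<lambda>n. ereal (norm (y + T (u n)))))"

definition property_o ::
  "('k::{real_normed_field,euclidean_space} \<Rightarrow> 'a::real_normed_vector \<Rightarrow> 'a) \<Rightarrow>
   ('k \<Rightarrow> 'b::real_normed_vector \<Rightarrow> 'b) \<Rightarrow> bool" where
  "property_o sX sY \<longleftrightarrow>
     (\<forall>T\<in>bounded_operators sX sY. min_modulus T \<ge> 1 \<longrightarrow> operator_property_o sX T)"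

end

theory Submission
  imports Defs "HOL-Complex_Analysis.Great_Picard"
begin

text \<open>
  Let \<open>u\<close> be a minimizing sequence for \<open>T\<close> that is not weakly null. By reflexivity a subsequence \<open>v\<close>
  converges weakly to some \<open>x \<noteq> 0\<close>. If \<open>m(T) = 0\<close>, weak lower semicontinuity gives \<open>T x = 0\<close>.
  Otherwise rescale to \<open>m(T) = 1\<close> and put \<open>w = v - x\<close>, a weakly null sequence. If
  \<open>s = \<parallel>T x\<parallel> / \<parallel>x\<parallel> > 1\<close>, then \<open>s (x + w) = (s x + w) + (s - 1) w\<close>, where property (m) bounds
  \<open>limsup \<parallel>s x + w\<parallel>\<close> by \<open>limsup \<parallel>T x + T w\<parallel> = 1\<close> and property (o) gives \<open>limsup \<parallel>w\<parallel> < 1\<close>; hence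
  \<open>s < s\<close>, a contradiction. So \<open>x / \<parallel>x\<parallel>\<close> attains the minimum modulus.

  Weak sequential compactness is obtained from Hahn-Banach alone. Diagonalise over a countable norming
  family for the closed span of the sequence. Every subsequence has a weak limit candidate: extend the
  functional `limit along the subsequence' to the whole dual and represent it by reflexivity. The
  candidates lie in the closed span, where the norming family identifies them. Scalars in \<open>'k\<close> are
  handled by passing to real functionals.
\<close>

section \<open>The Hahn-Banach theorem\<close>

text \<open>Homogeneity is required only as an inequality for positive scalars, which is the form
  easiest to check for an infimum. Applying it to \<open>c\<close> and \<open>1 / c\<close> restores
  equality.\<close>

definition sublinear :: "('v::real_vector \<Rightarrow> real) \<Rightarrow> bool" where
  "sublinear p \<longleftrightarrow> (\<forall>x y. p (x + y) \<le> p x + p y) \<and> (\<forall>c>0. \<forall>x. p (c *\<^sub>R x) \<le> c * p x)"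

lemma sublinear_add: "sublinear p \<Longrightarrow> p (x + y) \<le> p x + p y"
  by (simp add: sublinear_def)

lemma sublinear_scale_pos:
  assumes "sublinear p" "c > 0"
  shows "p (c *\<^sub>R x) = c * p x"
proof (rule antisym)
  show "p (c *\<^sub>R x) \<le> c * p x"
    using assms by (simp add: sublinear_def)
  have "p ((1 / c) *\<^sub>R c *\<^sub>R x) \<le> (1 / c) * p (c *\<^sub>R x)"
    using assms unfolding sublinear_def by (meson zero_less_divide_1_iff)
  then show "c * p x \<le> p (c *\<^sub>R x)"
    using assms(2) by (simp add: field_simps)
qed

lemma sublinear_zero:
  assumes "sublinear p"
  shows "p 0 = 0"
  using sublinear_scale_pos[OF assms, of 2 0] by simp

lemma sublinear_scale: "sublinear p \<Longrightarrow> c \<ge> 0 \<Longrightarrow> p (c *\<^sub>R x) = c * p x"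
  by (cases "c = 0") (auto simp: sublinear_zero sublinear_scale_pos)

lemma sublinear_minus: "sublinear p \<Longrightarrow> - p (- x) \<le> p x"
  using sublinear_add[of p x "- x"] sublinear_zero[of p] by simp

text \<open>
  The witness is \<open>q x = inf {p (x + t y) - t p y | t \<ge> 0}\<close>, which makes additivity of a minimal
  sublinear functional immediate.
\<close>

lemma sublinear_tilt:
  fixes p :: "'v::real_vector \<Rightarrow> real"
  assumes p: "sublinear p"
  obtains q where "sublinear q" "\<And>x. q x \<le> p x" "\<And>x. q x \<le> p (x + y) - p y"
proof -
  define g where "g x t = p (x + t *\<^sub>R y) - t * p y" for x t
  define q where "q x = (INF t\<in>{0..}. g x t)" for x
  \<comment> \<open>The bound \<open>- p (- x)\<close> does not depend on \<open>t\<close>, so the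
    infimum defining \<open>q\<close> is a genuine one.\<close>
  have bdd: "bdd_below (g x ` {0..})" for x
  proof (rule bdd_belowI2)
    fix t :: real assume "t \<in> {0..}"
    then have "t * p y = p ((x + t *\<^sub>R y) + (- x))"
      using sublinear_scale[OF p] by simp
    also have "\<dots> \<le> p (x + t *\<^sub>R y) + p (- x)"
      by (rule sublinear_add[OF p])
    finally show "- p (- x) \<le> g x t" by (simp add: g_def)
  qed
  have le: "q x \<le> g x t" if "t \<ge> 0" for x t
    unfolding q_def using bdd that by (intro cINF_lower) auto
  have "q (x + z) \<le> q x + q z" for x z
  proof -
    \<comment> \<open>Parameters \<open>s\<close> for \<open>x\<close> and \<open>t\<close> for
      \<open>z\<close> combine to the admissible parameter \<open>s + t\<close> for
      \<open>x + z\<close>. The two infima are then taken one after the other.\<close>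
    have 1: "q (x + z) - g z t \<le> g x s" if "s \<ge> 0" "t \<ge> 0" for s t
    proof -
      have "q (x + z) \<le> g (x + z) (s + t)" using le that by simp
      also have "\<dots> = p ((x + s *\<^sub>R y) + (z + t *\<^sub>R y)) - s * p y - t * p y"
        by (simp add: g_def algebra_simps)
      also have "\<dots> \<le> g x s + g z t"
        using sublinear_add[OF p, of "x + s *\<^sub>R y" "z + t *\<^sub>R y"] by (simp add: g_def)
      finally show ?thesis by simp
    qed
    have "q (x + z) - g z t \<le> q x" if "t \<ge> 0" for t
      unfolding q_def[of x] using 1 that by (intro cINF_greatest) auto
    then have "q (x + z) - q x \<le> g z t" if "t \<ge> 0" for t
      using that by (force simp: algebra_simps)
    then have "q (x + z) - q x \<le> q z"
      unfolding q_def[of z] by (intro cINF_greatest) auto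
    then show ?thesis by simp
  qed
  moreover have "q (c *\<^sub>R x) \<le> c * q x" if c: "c > 0" for c x
  proof -
    \<comment> \<open>The parameter \<open>t\<close> at \<open>x\<close> corresponds to
      \<open>c * t\<close> at the scaled vector.\<close>
    have "q (c *\<^sub>R x) / c \<le> g x t" if "t \<ge> 0" for t
    proof -
      have "q (c *\<^sub>R x) \<le> g (c *\<^sub>R x) (c * t)" using le that c by simp
      also have "\<dots> = p (c *\<^sub>R (x + t *\<^sub>R y)) - c * t * p y"
        by (simp add: g_def algebra_simps)
      also have "\<dots> = c * g x t"
        by (subst sublinear_scale_pos[OF p c]) (simp add: g_def algebra_simps)
      finally show ?thesis using c by (simp add: field_simps)
    qed
    then have "q (c *\<^sub>R x) / c \<le> q x"
      unfolding q_def[of x] by (intro cINF_greatest) auto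
    then show ?thesis using c by (simp add: field_simps)
  qed
  ultimately have "sublinear q" by (simp add: sublinear_def)
  \<comment> \<open>The parameter 0 yields domination by \<open>p\<close>, and the parameter 1
    yields the tilted bound.\<close>
  then show thesis
    using that[of q] le[of 0] le[of 1] by (auto simp: g_def)
qed

text \<open>By minimality \<open>q\<close> equals each of its tilts, and the tilted bound then says
  that \<open>q\<close> is superadditive. Additivity makes \<open>q\<close> odd, which extends
  homogeneity to negative scalars.\<close>

lemma sublinear_minimal_linear:
  fixes q :: "'v::real_vector \<Rightarrow> real"
  assumes q: "sublinear q"
    and minimal: "\<And>r. sublinear r \<Longrightarrow> (\<And>x. r x \<le> q x) \<Longrightarrow> r = q"
  shows "linear q"
proof (rule linearI)
  have "q x + q y \<le> q (x + y)" for x y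
    using sublinear_tilt[OF q, of y] minimal by (smt (verit, best))
  then show add: "q (x + y) = q x + q y" for x y
    using sublinear_add[OF q, of x y] by (simp add: antisym)
  have neg: "q (- x) = - q x" for x
    using add[of x "- x"] sublinear_zero[OF q] by simp
  show "q (c *\<^sub>R x) = c *\<^sub>R q x" for c x
    using sublinear_scale[OF q, of c x] sublinear_scale[OF q, of "- c" x] neg[of "c *\<^sub>R x"]
    by (cases "c \<ge> 0") auto
qed

text \<open>Zorn's lemma yields a minimal sublinear functional below \<open>p\<close>, and minimal
  ones are linear. Pointwise infima bound chains from below.\<close>

lemma sublinear_dominates_linear:
  fixes p :: "'v::real_vector \<Rightarrow> real"
  assumes p: "sublinear p"
  obtains f where "linear f" "\<And>x. f x \<le> p x"
proof -
  define A where "A = {q. sublinear q \<and> (\<forall>x. q x \<le> p x)}"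
  \<comment> \<open>The order is reversed, so that a maximal element in the sense of Zorn is
    pointwise minimal.\<close>
  define P where "P q r \<longleftrightarrow> (\<forall>x. r x \<le> q x)" for q r :: "'v \<Rightarrow> real"
  have lower: "- p (- x) \<le> q x" if "q \<in> A" for q x
    using that sublinear_minus[of q x] unfolding A_def by (smt (verit) mem_Collect_eq)
  have "\<exists>m\<in>A. \<forall>a\<in>A. P m a \<longrightarrow> a = m"
  proof (rule predicate_Zorn)
    show "partial_order_on A (relation_of P A)"
    proof (rule partial_order_on_relation_ofI)
      show "P q s" if "P q r" "P r s" for q r s
        using that order_trans unfolding P_def by blast
      show "q = r" if "P q r" "P r q" for q r
        using that by (intro ext antisym) (auto simp: P_def)
    qed (simp add: P_def)
  next
    fix C assume C: "C \<in> Chains (relation_of P A)"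
    then have CA: "C \<subseteq> A" and chain: "\<And>q r. q \<in> C \<Longrightarrow> r \<in> C \<Longrightarrow> P q r \<or> P r q"
      by (auto simp: Chains_def relation_of_def)
    show "\<exists>u\<in>A. \<forall>a\<in>C. P a u"
    proof (cases "C = {}")
      case True
      then show ?thesis using p by (auto simp: A_def)
    next
      case False
      define u where "u x = (INF q\<in>C. q x)" for x
      have bdd: "bdd_below ((\<lambda>q. q x) ` C)" for x
        using CA lower by (intro bdd_belowI2[where m = "- p (- x)"]) auto
      have le: "u x \<le> q x" if "q \<in> C" for q x
        unfolding u_def using that bdd by (intro cINF_lower) auto
      have ge: "c \<le> u x" if "\<And>q. q \<in> C \<Longrightarrow> c \<le> q x" for c x
        unfolding u_def using that False by (intro cINF_greatest) auto
      have "u (x + y) \<le> u x + u y" for x y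
      proof -
        \<comment> \<open>Of the two chain members \<open>q\<close> and \<open>r\<close>, the
          smaller one lies below \<open>q\<close> at \<open>x\<close> and below \<open>r\<close> at
          \<open>y\<close>.\<close>
        have 1: "u (x + y) \<le> q x + r y" if q: "q \<in> C" and r: "r \<in> C" for q r
        proof -
          have "\<exists>s\<in>C. s x \<le> q x \<and> s y \<le> r y"
            using chain[OF q r] q r unfolding P_def by blast
          then obtain s where s: "s \<in> C" "s x \<le> q x" "s y \<le> r y" by blast
          then have "s (x + y) \<le> s x + s y"
            using CA by (auto simp: A_def intro: sublinear_add)
          then show ?thesis using le[OF s(1), of "x + y"] s by linarith
        qed
        have "u (x + y) - r y \<le> u x" if "r \<in> C" for r
          using 1[OF _ that] by (intro ge) (simp add: algebra_simps)
        then have "u (x + y) - u x \<le> u y"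
          by (intro ge) (simp add: algebra_simps)
        then show ?thesis by simp
      qed
      moreover have "u (c *\<^sub>R x) \<le> c * u x" if c: "c > 0" for c x
      proof -
        have "u (c *\<^sub>R x) / c \<le> q x" if "q \<in> C" for q
        proof -
          have "sublinear q" using that CA by (auto simp: A_def)
          then show ?thesis
            using le[OF that, of "c *\<^sub>R x"] c by (simp add: sublinear_scale_pos field_simps)
        qed
        then have "u (c *\<^sub>R x) / c \<le> u x" by (rule ge)
        then show ?thesis using c by (simp add: field_simps)
      qed
      moreover have "u x \<le> p x" for x
        using False CA le[of _ x] unfolding A_def by (smt (verit) ex_in_conv mem_Collect_eq subsetD)
      ultimately have "u \<in> A" by (simp add: A_def sublinear_def)
      then show ?thesis using le by (auto simp: P_def)
    qed
  qed
  then obtain m where m: "m \<in> A" and min: "\<And>a. a \<in> A \<Longrightarrow> P m a \<Longrightarrow> a = m" by blast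
  have "linear m"
  proof (rule sublinear_minimal_linear)
    show "sublinear m" using m by (simp add: A_def)
    fix r assume "sublinear r" "\<And>x. r x \<le> m x"
    then show "r = m"
      using m by (intro min) (auto simp: A_def P_def intro: order_trans)
  qed
  then show thesis using that m by (auto simp: A_def)
qed

text \<open>Tilting \<open>p\<close> at \<open>z\<close> before passing to a linear minorant takes
  the place of extending a functional from the span of \<open>z\<close>: at \<open>- z\<close> the
  tilted bound reads \<open>q (- z) \<le> - p z\<close>, which forces
  \<open>f z \<ge> p z\<close>.\<close>

lemma Hahn_Banach_sublinear:
  fixes p :: "'v::real_vector \<Rightarrow> real"
  assumes p: "sublinear p"
  obtains f where "linear f" "\<And>x. f x \<le> p x" "f z = p z"
proof -
  obtain q where q: "sublinear q" "\<And>x. q x \<le> p x" "\<And>x. q x \<le> p (x + z) - p z"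
    using sublinear_tilt[OF p] by metis
  obtain f where f: "linear f" "\<And>x. f x \<le> q x"
    using sublinear_dominates_linear[OF q(1)] by metis
  have "- f z \<le> - p z"
    using f(2)[of "- z"] q(3)[of "- z"] sublinear_zero[OF p] by (simp add: linear_neg[OF f(1)])
  with f q show thesis by (metis antisym neg_le_iff_le order_trans that)
qed

section \<open>Norming and separating functionals\<close>

lemma bounded_linear_if_le_norm:
  fixes f :: "'a::real_normed_vector \<Rightarrow> real"
  assumes f: "linear f" and le: "\<And>x. f x \<le> B * norm x"
  shows "bounded_linear f"
proof -
  have "\<bar>f x\<bar> \<le> norm x * B" for x
    using le[of x] le[of "- x"] by (simp add: linear_neg[OF f] abs_le_iff mult.commute)
  then show ?thesis
    using f by (intro bounded_linear.intro bounded_linear_axioms.intro exI[of _ B]) auto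
qed

lemma norming_functional:
  fixes z :: "'a::real_normed_vector"
  obtains f :: "'a \<Rightarrow> real" where "bounded_linear f" "\<And>x. \<bar>f x\<bar> \<le> norm x" "f z = norm z"
proof -
  have "sublinear (norm :: 'a \<Rightarrow> real)"
    by (simp add: sublinear_def norm_triangle_ineq)
  then obtain f :: "'a \<Rightarrow> real" where f: "linear f" "\<And>x. f x \<le> norm x" "f z = norm z"
    by (rule Hahn_Banach_sublinear[where z = z]) auto
  moreover have "\<bar>f x\<bar> \<le> norm x" for x
    using f(2)[of x] f(2)[of "- x"] by (simp add: linear_neg[OF f(1)] abs_le_iff)
  ultimately show thesis
    using bounded_linear_if_le_norm[of f 1] by (intro that[of f]) auto
qed

text \<open>The distance to \<open>S\<close> is sublinear because \<open>S\<close> is a subspace,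
  and positive at \<open>x\<close> because \<open>S\<close> is closed. A linear functional below it
  that agrees with it at \<open>x\<close> vanishes on \<open>S\<close>, since \<open>s\<close> and
  \<open>- s\<close> both have distance 0.\<close>

lemma separating_functional_closed_subspace:
  fixes S :: "'a::real_normed_vector set"
  assumes S: "subspace S" "closed S" and x: "x \<notin> S"
  obtains f :: "'a \<Rightarrow> real" where "bounded_linear f" "\<And>s. s \<in> S \<Longrightarrow> f s = 0" "f x \<noteq> 0"
proof -
  define p where "p y = infdist y S" for y
  have ne: "S \<noteq> {}" and zero: "0 \<in> S"
    using S(1) subspace_0 by auto
  have near: "\<exists>s\<in>S. norm (y - s) < p y + e" if "e > 0" for y e
    using cInf_lessD[of "dist y ` S" "p y + e"] ne that
    by (auto simp: p_def infdist_notempty dist_norm)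
  have le: "p y \<le> norm (y - s)" if "s \<in> S" for y s
    using infdist_le[OF that, of y] by (simp add: p_def dist_norm)
  have "p (y + z) \<le> p y + p z" for y z
  proof (rule field_le_epsilon)
    fix e :: real assume e: "e > 0"
    obtain s t where st: "s \<in> S" "t \<in> S"
      and "norm (y - s) < p y + e / 2" "norm (z - t) < p z + e / 2"
      using near[of "e / 2"] e by (meson half_gt_zero)
    moreover have "p (y + z) \<le> norm ((y - s) + (z - t))"
      using le[of "s + t" "y + z"] st subspace_add[OF S(1)] by (simp add: algebra_simps)
    ultimately show "p (y + z) \<le> p y + p z + e"
      using norm_triangle_ineq[of "y - s" "z - t"] by linarith
  qed
  moreover have "p (c *\<^sub>R y) \<le> c * p y" if c: "c > 0" for c y
  proof (rule field_le_epsilon)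
    fix e :: real assume e: "e > 0"
    obtain s where s: "s \<in> S" "norm (y - s) < p y + e / c"
      using near[of "e / c"] e c by auto
    have "p (c *\<^sub>R y) \<le> norm (c *\<^sub>R (y - s))"
      using le[of "c *\<^sub>R s" "c *\<^sub>R y"] s(1) subspace_scale[OF S(1)] by (simp add: algebra_simps)
    also have "\<dots> \<le> c * (p y + e / c)"
      using s(2) c by simp
    finally show "p (c *\<^sub>R y) \<le> c * p y + e"
      using c by (simp add: distrib_left)
  qed
  ultimately have "sublinear p" by (simp add: sublinear_def)
  then obtain f where f: "linear f" "\<And>y. f y \<le> p y" "f x = p x"
    by (rule Hahn_Banach_sublinear[where z = x]) auto
  show thesis
  proof (rule that)
    show "bounded_linear f"
      using f le[OF zero] by (intro bounded_linear_if_le_norm[of f 1]) (auto intro: order_trans)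
    show "f s = 0" if "s \<in> S" for s
      using f(2)[of s] f(2)[of "- s"] le[OF that, of s] le[of "- s" "- s"] that
        subspace_neg[OF S(1) that] by (simp add: linear_neg[OF f(1)])
    have "p x \<noteq> 0"
      using in_closure_iff_infdist_zero[OF ne, of x] x S(2) by (simp add: p_def)
    then show "f x \<noteq> 0" by (simp add: f(3))
  qed
qed

section \<open>Weak sequential compactness\<close>

text \<open>The limit superior along \<open>y\<close> is sublinear on the dual. A linear functional
  below it also lies above the limit inferior, hence equals the limit wherever that exists, in the
  manner of a Banach limit.\<close>

lemma limit_functional:
  fixes y :: "nat \<Rightarrow> 'a::real_normed_vector"
  assumes bdd: "\<And>n. norm (y n) \<le> B"
  obtains \<Phi> :: "('a \<Rightarrow>\<^sub>L real) \<Rightarrow> real"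
  where "bounded_linear \<Phi>"
    "\<And>r l. (\<lambda>n. blinfun_apply r (y n)) \<longlonglongrightarrow> l \<Longrightarrow> \<Phi> r = l"
proof -
  \<comment> \<open>\<open>p r\<close> is the limit superior of \<open>r (y n)\<close>.\<close>
  define E where "E r = {t. \<forall>\<^sub>F n in sequentially. blinfun_apply r (y n) \<le> t}"
    for r :: "'a \<Rightarrow>\<^sub>L real"
  define p where "p r = Inf (E r)" for r
  have bound: "\<bar>blinfun_apply r (y n)\<bar> \<le> B * norm r" for r :: "'a \<Rightarrow>\<^sub>L real" and n
  proof -
    have "\<bar>blinfun_apply r (y n)\<bar> \<le> norm r * norm (y n)"
      using norm_blinfun[of r "y n"] by simp
    also have "\<dots> \<le> norm r * B" by (intro mult_left_mono bdd) auto
    finally show ?thesis by (simp add: mult.commute)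
  qed
  have mem: "B * norm r \<in> E r" for r
    using bound[of r] by (auto simp: E_def abs_le_iff)
  have lower: "- (B * norm r) \<le> t" if t: "t \<in> E r" for r t
  proof -
    obtain n where "blinfun_apply r (y n) \<le> t"
      using t eventually_happens[of _ sequentially] by (auto simp: E_def)
    then show ?thesis using bound[of r n] by linarith
  qed
  have le: "p r \<le> t" if "t \<in> E r" for r t
    unfolding p_def using that lower by (intro cInf_lower) (auto simp: bdd_below_def)
  have near: "\<exists>t\<in>E r. t < p r + e" if "e > 0" for r e
    using cInf_lessD[of "E r" "p r + e"] mem that unfolding p_def by force
  have "p (r + s) \<le> p r + p s" for r s
  proof (rule field_le_epsilon)
    fix e :: real assume "e > 0"
    then obtain t u where tu: "t \<in> E r" "u \<in> E s" "t < p r + e / 2" "u < p s + e / 2"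
      using near[of "e / 2"] by (meson half_gt_zero)
    have "t + u \<in> E (r + s)"
      using tu(1,2) unfolding E_def mem_Collect_eq
      by eventually_elim (simp add: plus_blinfun.rep_eq)
    then show "p (r + s) \<le> p r + p s + e" using le tu(3,4) by fastforce
  qed
  moreover have "p (c *\<^sub>R r) \<le> c * p r" if c: "c > 0" for c r
  proof (rule field_le_epsilon)
    fix e :: real assume "e > 0"
    then obtain t where t: "t \<in> E r" "t < p r + e / c"
      using near[of "e / c"] c by auto
    have "c * t \<in> E (c *\<^sub>R r)"
      using t(1) c unfolding E_def mem_Collect_eq
      by (auto elim!: eventually_mono simp: scaleR_blinfun.rep_eq)
    moreover have "c * t \<le> c * (p r + e / c)"
      using t(2) c by simp
    ultimately show "p (c *\<^sub>R r) \<le> c * p r + e"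
      using le[of "c * t" "c *\<^sub>R r"] c by (simp add: distrib_left)
  qed
  ultimately have "sublinear p" by (simp add: sublinear_def)
  then obtain \<Phi> where \<Phi>: "linear \<Phi>" "\<And>r. \<Phi> r \<le> p r"
    using sublinear_dominates_linear by metis
  \<comment> \<open>This is one half of the identification with the limit; the other half follows by
    applying it to \<open>- r\<close>.\<close>
  have upper: "\<Phi> r \<le> l" if "(\<lambda>n. blinfun_apply r (y n)) \<longlonglongrightarrow> l" for r l
  proof (rule field_le_epsilon)
    fix e :: real assume "e > 0"
    then have "l + e \<in> E r"
      using order_tendstoD(2)[OF that, of "l + e"]
      by (auto simp: E_def elim: eventually_mono)
    then show "\<Phi> r \<le> l + e" using \<Phi>(2)[of r] le by fastforce
  qed
  show thesis
  proof (rule that)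
    show "bounded_linear \<Phi>"
      using \<Phi> le[OF mem] by (intro bounded_linear_if_le_norm[of _ B]) (auto intro: order_trans)
    show "\<Phi> r = l" if r: "(\<lambda>n. blinfun_apply r (y n)) \<longlonglongrightarrow> l" for r l
    proof (rule antisym)
      have "(\<lambda>n. blinfun_apply (- r) (y n)) \<longlonglongrightarrow> - l"
        using tendsto_minus[OF r] by (simp add: uminus_blinfun.rep_eq)
      then show "l \<le> \<Phi> r"
        using upper linear_neg[OF \<Phi>(1)] by fastforce
    qed (rule upper[OF r])
  qed
qed

text \<open>\<open>D\<close> consists of the rational linear combinations of the sequence. Density
  of the rationals in the reals turns its closure into a real subspace.\<close>

lemma countable_dense_in_closed_span:
  fixes y :: "nat \<Rightarrow> 'a::real_normed_vector"
  obtains D where "countable D" "subspace (closure D)" "range y \<subseteq> closure D"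
proof -
  \<comment> \<open>Stage \<open>n\<close> holds the rational combinations of \<open>y 0\<close>,
    ..., \<open>y (n - 1)\<close>; stage 0 holds only the zero vector.\<close>
  define G where "G = rec_nat {0::'a} (\<lambda>n A. (\<lambda>(d, q). d + q *\<^sub>R y n) ` (A \<times> \<rat>))"
  define D where "D = (\<Union>n. G n)"
  have G0: "G 0 = {0}" and GS: "G (Suc n) = (\<lambda>(d, q). d + q *\<^sub>R y n) ` (G n \<times> \<rat>)" for n
    by (simp_all add: G_def)
  have "countable (G n)" for n
    by (induction n) (auto simp: G0 GS countable_rat)
  then have "countable D" by (simp add: D_def)
  have G_add: "a + b \<in> G n" if "a \<in> G n" "b \<in> G n" for a b n
    using that
  proof (induction n arbitrary: a b)
    case (Suc n)
    then obtain c d q r where *: "c \<in> G n" "d \<in> G n" "q \<in> \<rat>" "r \<in> \<rat>"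
      "a = c + q *\<^sub>R y n" "b = d + r *\<^sub>R y n" by (auto simp: GS)
    then have "a + b = (c + d) + (q + r) *\<^sub>R y n" by (simp add: algebra_simps)
    with * Suc.IH[of c d] show ?case by (force simp: GS)
  qed (simp add: G0)
  have G_scale: "q *\<^sub>R a \<in> G n" if "a \<in> G n" "q \<in> \<rat>" for a q n
    using that
  proof (induction n arbitrary: a)
    case (Suc n)
    then obtain c r where *: "c \<in> G n" "r \<in> \<rat>" "a = c + r *\<^sub>R y n" by (auto simp: GS)
    then have "q *\<^sub>R a = q *\<^sub>R c + (q * r) *\<^sub>R y n" by (simp add: algebra_simps)
    with * Suc show ?case by (force simp: GS)
  qed (simp add: G0)
  have "G n \<subseteq> G (Suc n)" for n
    by (force simp: GS)
  then have mono: "G m \<subseteq> G n" if "m \<le> n" for m n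
    using that by (rule lift_Suc_mono_le)
  have zero: "0 \<in> G n" for n
    using mono[of 0 n] by (simp add: G0)
  have D_add: "a + b \<in> D" if ab: "a \<in> D" "b \<in> D" for a b
  proof -
    obtain m n where "a \<in> G m" "b \<in> G n" using ab by (auto simp: D_def)
    then have "a \<in> G (max m n)" "b \<in> G (max m n)"
      using mono[of m "max m n"] mono[of n "max m n"] by auto
    then show ?thesis using G_add by (auto simp: D_def)
  qed
  have add: "a + b \<in> closure D" if a: "a \<in> closure D" and b: "b \<in> closure D" for a b
  proof -
    obtain f g where "\<forall>n. f n \<in> D" "f \<longlonglongrightarrow> a" "\<forall>n. g n \<in> D" "g \<longlonglongrightarrow> b"
      using a b by (auto simp: closure_sequential)
    then show ?thesis
      unfolding closure_sequential by (intro exI[of _ "\<lambda>n. f n + g n"]) (auto intro: D_add tendsto_add)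
  qed
  have scale: "c *\<^sub>R a \<in> closure D" if a: "a \<in> closure D" for c a
  proof -
    obtain f where f: "\<forall>n. f n \<in> D" "f \<longlonglongrightarrow> a"
      using a by (auto simp: closure_sequential)
    have "c \<in> closure \<rat>" by (simp add: Rats_closure_real)
    then obtain q where q: "\<forall>n. q n \<in> \<rat>" "q \<longlonglongrightarrow> c"
      by (auto simp: closure_sequential)
    have "q n *\<^sub>R f n \<in> D" for n
    proof -
      obtain m where "f n \<in> G m" using f(1) by (auto simp: D_def)
      then have "q n *\<^sub>R f n \<in> G m" using G_scale q(1) by blast
      then show ?thesis by (auto simp: D_def)
    qed
    then show ?thesis
      using f(2) q(2) unfolding closure_sequential
      by (intro exI[of _ "\<lambda>n. q n *\<^sub>R f n"]) (auto intro: tendsto_scaleR)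
  qed
  have "0 \<in> closure D"
    using zero by (intro subsetD[OF closure_subset]) (auto simp: D_def)
  then have "subspace (closure D)"
    using add scale by (simp add: subspace_def)
  moreover have "y n \<in> D" for n
  proof -
    have "0 + 1 *\<^sub>R y n \<in> G (Suc n)"
      unfolding GS using zero by (intro image_eqI[of _ _ "(0, 1)"]) auto
    then show ?thesis by (auto simp: D_def)
  qed
  then have "range y \<subseteq> closure D"
    by (auto intro: subsetD[OF closure_subset])
  ultimately show thesis
    by (rule that[OF \<open>countable D\<close>])
qed

text \<open>Diagonalisation controls only the functionals \<open>F d\<close> with \<open>d\<close>
  in \<open>D\<close>. All other functionals are reached by contradiction: a subsequence on which
  one of them stays away from \<open>r x\<close> would have a second limit candidate, yet the
  \<open>F d\<close> allow only one.\<close>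

lemma weakly_convergent_subsequence:
  fixes y :: "nat \<Rightarrow> 'a::real_normed_vector"
  assumes reflexive: "\<And>\<Phi> :: ('a \<Rightarrow>\<^sub>L real) \<Rightarrow> real. bounded_linear \<Phi> \<Longrightarrow>
      \<exists>x. \<forall>r. \<Phi> r = blinfun_apply r x"
    and bdd: "\<And>n. norm (y n) \<le> B"
  obtains s x where "strict_mono s"
    "\<And>r :: 'a \<Rightarrow> real. bounded_linear r \<Longrightarrow> (\<lambda>n. r (y (s n))) \<longlonglongrightarrow> r x"
proof -
  obtain D where D: "countable D" "subspace (closure D)" "range y \<subseteq> closure D"
    by (rule countable_dense_in_closed_span)
  have "\<exists>f :: 'a \<Rightarrow> real. bounded_linear f \<and> (\<forall>x. \<bar>f x\<bar> \<le> norm x) \<and> f d = norm d" for d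
    by (rule norming_functional[of d]) blast
  then obtain F :: "'a \<Rightarrow> 'a \<Rightarrow> real" where F: "\<And>d. bounded_linear (F d)"
      "\<And>d x. \<bar>F d x\<bar> \<le> norm x" "\<And>d. F d d = norm d"
    by metis
  have "norm (F d (y n)) \<le> B" for d n
    using F(2)[of d "y n"] bdd[of n] by simp
  then obtain s where s: "strict_mono s" "\<And>d. d \<in> D \<Longrightarrow> \<exists>l. (\<lambda>n. F d (y (s n))) \<longlonglongrightarrow> l"
    using function_convergent_subsequence[OF D(1), of "\<lambda>n d. F d (y n)" B] by blast
  \<comment> \<open>The point found here is only a candidate: it has the right value on those
    functionals that converge along \<open>t\<close>.\<close>
  have cluster: "\<exists>x \<in> closure D. \<forall>(r :: 'a \<Rightarrow> real) l. bounded_linear r \<longrightarrow> (\<lambda>n. r (y (t n))) \<longlonglongrightarrow> l \<longrightarrow> r x = l"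
    for t :: "nat \<Rightarrow> nat"
  proof -
    obtain \<Phi> :: "('a \<Rightarrow>\<^sub>L real) \<Rightarrow> real" where \<Phi>: "bounded_linear \<Phi>"
      "\<And>r l. (\<lambda>n. blinfun_apply r (y (t n))) \<longlonglongrightarrow> l \<Longrightarrow> \<Phi> r = l"
      by (rule limit_functional[of "\<lambda>n. y (t n)" B]) (use bdd in auto)
    obtain x where x: "\<And>r. \<Phi> r = blinfun_apply r x"
      using reflexive[OF \<Phi>(1)] by blast
    have lim: "r x = l" if "bounded_linear r" "(\<lambda>n. r (y (t n))) \<longlonglongrightarrow> l"
      for r :: "'a \<Rightarrow> real" and l
      using \<Phi>(2)[of "Blinfun r" l] x that by (simp add: bounded_linear_Blinfun_apply)
    moreover have "x \<in> closure D"
    proof (rule ccontr)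
      assume "x \<notin> closure D"
      \<comment> \<open>A functional vanishing on \<open>closure D\<close> is zero along the
        sequence, so its limit 0 must be its value at \<open>x\<close>.\<close>
      then obtain f :: "'a \<Rightarrow> real" where f: "bounded_linear f" "\<And>z. z \<in> closure D \<Longrightarrow> f z = 0" "f x \<noteq> 0"
        using separating_functional_closed_subspace[OF D(2)] by (metis closed_closure)
      have "f (y n) = 0" for n
        using D(3) by (intro f(2)) auto
      then have "f x = 0"
        by (intro lim f(1)) simp
      with f(3) show False by simp
    qed
    ultimately show ?thesis by blast
  qed
  obtain x where x: "x \<in> closure D"
    and lim_x: "\<And>(r :: 'a \<Rightarrow> real) l. bounded_linear r \<Longrightarrow> (\<lambda>n. r (y (s n))) \<longlonglongrightarrow> l \<Longrightarrow> r x = l"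
    using cluster[of s] by blast
  \<comment> \<open>The family \<open>F\<close> norms the dense set \<open>D\<close>, hence separates the points of its closure.\<close>
  have unique: "x' = x" if x': "x' \<in> closure D" and eq: "\<And>d. d \<in> D \<Longrightarrow> F d x' = F d x" for x'
  proof -
    have "norm (x' - x) \<le> 0"
    proof (rule field_le_epsilon)
      fix e :: real assume "e > 0"
      moreover have "x' - x \<in> closure D"
        using subspace_diff[OF D(2) x' x] .
      ultimately obtain d where d: "d \<in> D" "dist d (x' - x) < e / 2"
        using closure_approachable[of "x' - x" D] by (meson half_gt_zero)
      have "F d (x' - x) = 0"
        using eq[OF d(1)] linear_diff[OF bounded_linear.linear[OF F(1)[of d]]] by simp
      \<comment> \<open>As \<open>F d\<close> kills \<open>x' - x\<close>, the norm of
        \<open>d\<close> is at most its distance to \<open>x' - x\<close>. That distance is below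
        \<open>e / 2\<close>, so \<open>x' - x\<close> has norm below \<open>e\<close>.\<close>
      then have "norm d = F d (d - (x' - x))"
        using F(3) linear_diff[OF bounded_linear.linear[OF F(1)[of d]]] by simp
      also have "\<dots> \<le> norm (d - (x' - x))"
        using F(2)[of d "d - (x' - x)"] by simp
      finally show "norm (x' - x) \<le> 0 + e"
        using d(2) norm_triangle_ineq2[of "x' - x" d] by (simp add: dist_norm norm_minus_commute)
    qed
    then show ?thesis by simp
  qed
  have "(\<lambda>n. r (y (s n))) \<longlonglongrightarrow> r x" if r: "bounded_linear r" for r :: "'a \<Rightarrow> real"
  proof (rule ccontr)
    assume "\<not> (\<lambda>n. r (y (s n))) \<longlonglongrightarrow> r x"
    then obtain e where e: "e > 0" and freq: "\<exists>\<^sub>F n in sequentially. e \<le> dist (r (y (s n))) (r x)"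
      unfolding tendsto_iff by (auto simp: not_eventually not_less)
    have "infinite {n. e \<le> dist (r (y (s n))) (r x)}"
      using freq by (simp add: frequently_cofinite flip: cofinite_eq_sequentially)
    then obtain t :: "nat \<Rightarrow> nat" where t: "strict_mono t" "\<And>n. e \<le> dist (r (y (s (t n)))) (r x)"
      using infinite_enumerate[of "{n. e \<le> dist (r (y (s n))) (r x)}"] by auto
    obtain K where K: "K \<ge> 0" "\<forall>z. norm (r z) \<le> norm z * K"
      using bounded_linear.nonneg_bounded[OF r] by (elim exE conjE)
    have "bounded (range (\<lambda>n. r (y (s (t n)))))"
      unfolding bounded_iff
    proof (intro exI[of _ "B * K"] ballI, clarify)
      fix n
      show "norm (r (y (s (t n)))) \<le> B * K"
        using K(2)[rule_format, of "y (s (t n))"] mult_right_mono[OF bdd[of "s (t n)"] K(1)] by linarith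
    qed
    then obtain l v where v: "strict_mono v" "(\<lambda>n. r (y (s (t (v n))))) \<longlonglongrightarrow> l"
      using bounded_imp_convergent_subsequence[of "\<lambda>n. r (y (s (t n)))"] by (auto simp: o_def)
    obtain x' where x': "x' \<in> closure D"
      and lim_x': "\<And>(r :: 'a \<Rightarrow> real) l. bounded_linear r \<Longrightarrow> (\<lambda>n. r (y (s (t (v n))))) \<longlonglongrightarrow> l \<Longrightarrow> r x' = l"
      using cluster[of "\<lambda>n. s (t (v n))"] by blast
    \<comment> \<open>Passing to a further subsequence keeps the limit of \<open>F d\<close>, so
      both candidates take that value.\<close>
    have "F d x' = F d x" if d: "d \<in> D" for d
    proof -
      obtain c where c: "(\<lambda>n. F d (y (s n))) \<longlonglongrightarrow> c"
        using s(2)[OF d] by blast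
      have "(\<lambda>n. F d (y (s (t (v n))))) \<longlonglongrightarrow> c"
        using LIMSEQ_subseq_LIMSEQ[OF c strict_mono_o[OF t(1) v(1)]] by (simp add: o_def)
      then show ?thesis
        using lim_x[OF F(1) c] lim_x'[OF F(1)] by simp
    qed
    then have "x' = x" by (rule unique[OF x'])
    then have "r x = l" using lim_x'[OF r v(2)] by simp
    then have "(\<lambda>n. dist (r (y (s (t (v n))))) (r x)) \<longlonglongrightarrow> 0"
      using tendsto_dist[OF v(2) tendsto_const[of "r x"]] by simp
    then have "e \<le> 0"
      using t(2) by (intro LIMSEQ_le_const) auto
    with e show False by simp
  qed
  with s(1) show thesis by (rule that)
qed

section \<open>Reduction to real functionals\<close>

text \<open>A fixed nonzero real functional on the scalars, in the role that the real part plays for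
  complex scalars.\<close>

definition coord :: "'k::{real_normed_field,euclidean_space} \<Rightarrow> real" where
  "coord a = a \<bullet> (SOME b. b \<in> Basis)"

lemma bounded_linear_coord: "bounded_linear coord"
  unfolding coord_def by (rule bounded_linear_inner_left)

lemma coord_add: "coord (a + b) = coord a + coord b"
  by (simp add: coord_def inner_add_left)

lemma coord_diff: "coord (a - b) = coord a - coord b"
  by (simp add: coord_def inner_diff_left)

lemma coord_scaleR: "coord (r *\<^sub>R a) = r * coord a"
  by (simp add: coord_def)

text \<open>For nonzero \<open>a\<close> the multiplier \<open>b * inverse a\<close> carries
  \<open>a\<close> to the basis vector \<open>b\<close>, where \<open>coord\<close> is 1; its own
  norm is \<open>1 / norm a\<close>.\<close>

lemma norm_le_if_coord_le:
  fixes a :: "'k::{real_normed_field,euclidean_space}"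
  assumes le: "\<And>c. coord (c * a) \<le> M * norm c"
  shows "norm a \<le> M"
proof (cases "a = 0")
  case True
  then show ?thesis using le[of 1] by (simp add: coord_def)
next
  case False
  define b :: 'k where "b = (SOME b. b \<in> Basis)"
  have b: "b \<in> Basis" unfolding b_def by (rule some_in_eq[THEN iffD2]) (rule nonempty_Basis)
  have "1 = coord ((b * inverse a) * a)"
    using False b by (simp add: coord_def mult.assoc flip: b_def)
  also have "\<dots> \<le> M * (1 / norm a)"
    using le[of "b * inverse a"] b by (simp add: norm_mult norm_inverse divide_inverse)
  finally show ?thesis using False by (simp add: field_simps)
qed

lemma coord_eqI:
  assumes "\<And>c. coord (c * a) = coord (c * b)"
  shows "a = b"
  using norm_le_if_coord_le[of "a - b" 0] assms by (simp add: right_diff_distrib coord_diff)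

text \<open>
  The bilinear form \<open>coord (c * a)\<close> is nondegenerate because \<open>'k\<close> is a field, so it identifies \<open>'k\<close>
  with its real dual.
\<close>

lemma linear_imp_coord:
  fixes h :: "'k::{real_normed_field,euclidean_space} \<Rightarrow> real"
  assumes h: "linear h"
  shows "\<exists>a. \<forall>c. h c = coord (c * a)"
proof -
  \<comment> \<open>\<open>L a\<close> is the Riesz representer of the functional sending
    \<open>c\<close> to \<open>coord (c * a)\<close>. Injectivity of \<open>L\<close> gives
    surjectivity by finite dimension.\<close>
  define L where "L a = (\<Sum>b\<in>Basis. coord (b * a) *\<^sub>R b)" for a :: 'k
  have rep: "g c = c \<bullet> (\<Sum>b\<in>Basis. g b *\<^sub>R b)" if g: "linear g" for g :: "'k \<Rightarrow> real" and c
  proof -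
    have "g c = g (\<Sum>b\<in>Basis. (c \<bullet> b) *\<^sub>R b)" by (simp add: euclidean_representation)
    also have "\<dots> = c \<bullet> (\<Sum>b\<in>Basis. g b *\<^sub>R b)"
      by (simp add: linear_sum[OF g] linear_scale[OF g] inner_sum_right mult.commute)
    finally show ?thesis .
  qed
  have lin_mult: "linear (\<lambda>c. coord (c * a))" for a :: 'k
    by (rule linearI) (simp_all add: coord_add distrib_right coord_scaleR)
  have L: "coord (c * a) = c \<bullet> L a" for a c
    unfolding L_def by (rule rep[OF lin_mult])
  have "linear L"
    unfolding L_def
    by (rule linearI)
      (simp_all add: distrib_left coord_add scaleR_add_left sum.distrib coord_scaleR scaleR_sum_right)
  moreover have "inj L"
  proof (rule injI)
    fix a b assume "L a = L b"
    then have "coord (c * a) = coord (c * b)" for c by (simp only: L)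
    then show "a = b" by (rule coord_eqI)
  qed
  ultimately have "surj L"
    by (rule linear_injective_imp_surjective) simp
  then obtain a where "(\<Sum>b\<in>Basis. h b *\<^sub>R b) = L a" by (rule surjE)
  then have "h c = coord (c * a)" for c
    by (simp only: rep[OF h, of c] L)
  then show ?thesis by blast
qed

section \<open>Duals and reflexivity over the scalar field and over the reals\<close>

lemma bounded_operators_iff:
  assumes "normed_space_over sX" "normed_space_over sY"
  shows "T \<in> bounded_operators sX sY \<longleftrightarrow>
    (\<forall>x y. T (x + y) = T x + T y) \<and> (\<forall>c x. T (sX c x) = sY c (T x)) \<and>
    (\<exists>B. \<forall>x. norm (T x) \<le> B * norm x)"
  using assms by (auto simp: bounded_operators_def Vector_Spaces.linear_iff normed_space_over_def)

lemma bounded_operators_bounded_linear: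
  assumes "normed_space_over sX" "normed_space_over sY" "T \<in> bounded_operators sX sY"
  shows "bounded_linear T"
proof -
  have T: "\<And>x y. T (x + y) = T x + T y" "\<And>c x. T (sX c x) = sY c (T x)"
    and "\<exists>B. \<forall>x. norm (T x) \<le> B * norm x"
    using assms by (auto simp: bounded_operators_iff)
  then obtain B where B: "\<forall>x. norm (T x) \<le> B * norm x" by blast
  show ?thesis
  proof (rule bounded_linear_intro)
    show "T (r *\<^sub>R x) = r *\<^sub>R T x" for r x
      using T(2)[of "of_real r" x] assms(1,2) by (simp add: normed_space_over.scale_of_real)
    show "norm (T x) \<le> norm x * B" for x
      using B by (simp add: mult.commute)
  qed (rule T(1))
qed

lemma dual_space_iff:
  assumes "normed_space_over sX"
  shows "f \<in> dual_space sX \<longleftrightarrow>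
    (\<forall>x y. f (x + y) = f x + f y) \<and> (\<forall>c x. f (sX c x) = c * f x) \<and>
    (\<exists>B. \<forall>x. norm (f x) \<le> B * norm x)"
  unfolding dual_space_def using bounded_operators_iff[OF assms normed_space_over_field] .

lemma dual_space_bounded_linear:
  "normed_space_over sX \<Longrightarrow> f \<in> dual_space sX \<Longrightarrow> bounded_linear f"
  unfolding dual_space_def by (rule bounded_operators_bounded_linear[OF _ normed_space_over_field])

text \<open>This generalises the fact that a real functional is the real part of a complex one. For
  fixed \<open>x\<close> the map \<open>c\<close> to \<open>r (sX c x)\<close> has the form
  \<open>coord (c * a)\<close>; its unique representer \<open>a\<close> is taken as
  \<open>f x\<close>, and uniqueness makes \<open>f\<close> linear.\<close>

lemma real_functional_is_coord:
  fixes sX :: "'k::{real_normed_field,euclidean_space} \<Rightarrow> 'a::real_normed_vector \<Rightarrow> 'a"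
    and r :: "'a \<Rightarrow> real"
  assumes X: "normed_space_over sX" and r: "bounded_linear r"
  obtains f where "f \<in> dual_space sX" "\<And>x. r x = coord (f x)"
proof -
  interpret normed_space_over sX by fact
  have "linear (\<lambda>c. r (sX c x))" for x
  proof (rule linearI)
    show "r (sX (c + d) x) = r (sX c x) + r (sX d x)" for c d
      by (simp add: scale_left_distrib linear_add[OF bounded_linear.linear[OF r]])
    show "r (sX (t *\<^sub>R c) x) = t *\<^sub>R r (sX c x)" for t c
    proof -
      have "sX (t *\<^sub>R c) x = t *\<^sub>R sX c x"
        by (simp add: scaleR_conv_of_real flip: scale_of_real)
      then show ?thesis
        by (simp add: linear_scale[OF bounded_linear.linear[OF r]])
    qed
  qed
  then have "\<forall>x. \<exists>a. \<forall>c. r (sX c x) = coord (c * a)"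
    using linear_imp_coord by blast
  then obtain f where f: "\<And>x c. r (sX c x) = coord (c * f x)" by metis
  obtain B where B: "\<And>x. norm (r x) \<le> norm x * B"
    using bounded_linear.bounded[OF r] by blast
  have "f \<in> dual_space sX"
    unfolding dual_space_iff[OF X]
  proof (intro conjI allI exI)
    show "f (x + y) = f x + f y" for x y
    proof (rule coord_eqI)
      fix c
      have "coord (c * f (x + y)) = r (sX c x + sX c y)"
        by (simp add: scale_right_distrib flip: f)
      then show "coord (c * f (x + y)) = coord (c * (f x + f y))"
        by (simp add: linear_add[OF bounded_linear.linear[OF r]] f distrib_left coord_add)
    qed
    show "f (sX d x) = d * f x" for d x
      by (rule coord_eqI) (simp flip: f mult.assoc)
    show "norm (f x) \<le> B * norm x" for x
    proof (rule norm_le_if_coord_le)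
      fix c
      have "coord (c * f x) \<le> norm (r (sX c x))" by (simp add: f)
      also have "\<dots> \<le> norm (sX c x) * B" by (rule B)
      finally show "coord (c * f x) \<le> B * norm x * norm c"
        by (simp add: norm_scale mult_ac)
    qed
  qed
  moreover have "r x = coord (f x)" for x
    using f[of 1 x] by simp
  ultimately show thesis by (rule that)
qed

text \<open>Real functionals are coordinates of dual elements; conversely the finitely many
  components of a dual element are real functionals.\<close>

lemma weakly_converges_to_iff_real:
  fixes sX :: "'k::{real_normed_field,euclidean_space} \<Rightarrow> 'a::real_normed_vector \<Rightarrow> 'a"
  assumes X: "normed_space_over sX"
  shows "weakly_converges_to sX u l \<longleftrightarrow>
    (\<forall>r :: 'a \<Rightarrow> real. bounded_linear r \<longrightarrow> (\<lambda>n. r (u n)) \<longlonglongrightarrow> r l)"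
proof (intro iffI allI impI)
  fix r :: "'a \<Rightarrow> real" assume u: "weakly_converges_to sX u l" and r: "bounded_linear r"
  obtain f where f: "f \<in> dual_space sX" "\<And>x. r x = coord (f x)"
    using real_functional_is_coord[OF X r] by blast
  show "(\<lambda>n. r (u n)) \<longlonglongrightarrow> r l"
    unfolding f(2)
    using u f(1) by (intro bounded_linear.tendsto[OF bounded_linear_coord]) (simp add: weakly_converges_to_def)
next
  assume u: "\<forall>r :: 'a \<Rightarrow> real. bounded_linear r \<longrightarrow> (\<lambda>n. r (u n)) \<longlonglongrightarrow> r l"
  show "weakly_converges_to sX u l"
    unfolding weakly_converges_to_def
  proof
    fix f assume "f \<in> dual_space sX"
    then have f: "bounded_linear f" by (rule dual_space_bounded_linear[OF X])
    show "(\<lambda>n. f (u n)) \<longlonglongrightarrow> f l"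
      unfolding tendsto_componentwise_iff[of "\<lambda>n. f (u n)"]
    proof
      fix b
      have "bounded_linear (\<lambda>x. f x \<bullet> b)"
        using bounded_linear_compose[OF bounded_linear_inner_left f] .
      then show "(\<lambda>n. f (u n) \<bullet> b) \<longlonglongrightarrow> f l \<bullet> b" using u by blast
    qed
  qed
qed

text \<open>A real functional on the real dual is lifted to a scalar-valued one on
  \<open>dual_space sX\<close>, by solving \<open>coord (c * \<Psi> f) = \<Phi> (J f c)\<close> for
  all \<open>c\<close>. Reflexivity represents the lift by a point, and \<open>c = 1\<close> leads
  back to \<open>\<Phi>\<close>.\<close>

lemma reflexive_space_real:
  fixes sX :: "'k::{real_normed_field,euclidean_space} \<Rightarrow> 'a::real_normed_vector \<Rightarrow> 'a"
    and \<Phi> :: "('a \<Rightarrow>\<^sub>L real) \<Rightarrow> real"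
  assumes X: "normed_space_over sX" and refl: "reflexive_space sX" and \<Phi>: "bounded_linear \<Phi>"
  shows "\<exists>x. \<forall>r. \<Phi> r = blinfun_apply r x"
proof -
  define J where "J f c = Blinfun (\<lambda>x. coord (c * f x))" for f :: "'a \<Rightarrow> 'k" and c
  have J: "blinfun_apply (J f c) x = coord (c * f x)" if "f \<in> dual_space sX" for f c x
  proof -
    have "bounded_linear (\<lambda>x. coord (c * f x))"
      using dual_space_bounded_linear[OF X that]
      by (intro bounded_linear_compose[OF bounded_linear_coord] bounded_linear_const_mult)
    then show ?thesis by (simp add: J_def bounded_linear_Blinfun_apply)
  qed
  note lin = bounded_linear.linear[OF \<Phi>]
  have "\<exists>a. \<forall>c. \<Phi> (J f c) = coord (c * a)" if f: "f \<in> dual_space sX" for f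
  proof (rule linear_imp_coord, rule linearI)
    have "J f (c + d) = J f c + J f d" for c d
      by (rule blinfun_eqI) (simp add: J f plus_blinfun.rep_eq distrib_right coord_add)
    then show "\<Phi> (J f (c + d)) = \<Phi> (J f c) + \<Phi> (J f d)" for c d
      by (simp add: linear_add[OF lin])
    have "J f (t *\<^sub>R c) = t *\<^sub>R J f c" for t c
      by (rule blinfun_eqI) (simp add: J f scaleR_blinfun.rep_eq coord_scaleR)
    then show "\<Phi> (J f (t *\<^sub>R c)) = t *\<^sub>R \<Phi> (J f c)" for t c
      by (simp add: linear_scale[OF lin])
  qed
  then have "\<forall>f. \<exists>a. f \<in> dual_space sX \<longrightarrow> (\<forall>c. \<Phi> (J f c) = coord (c * a))" by blast
  then obtain \<Psi> where \<Psi>: "\<And>f c. f \<in> dual_space sX \<Longrightarrow> \<Phi> (J f c) = coord (c * \<Psi> f)"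
    by metis
  have "bounded_functional_on_dual sX \<Psi>"
    unfolding bounded_functional_on_dual_def
  proof (intro conjI ballI allI)
    fix f g assume f: "f \<in> dual_space sX" and g: "g \<in> dual_space sX"
    obtain B C where "\<And>x. norm (f x) \<le> B * norm x" "\<And>x. norm (g x) \<le> C * norm x"
      using f g by (auto simp: dual_space_iff[OF X])
    then have "norm (f x + g x) \<le> (B + C) * norm x" for x
      using norm_triangle_mono[of "f x" "B * norm x" "g x" "C * norm x"]
      by (simp add: distrib_right)
    then have fg: "(\<lambda>x. f x + g x) \<in> dual_space sX"
      using f g unfolding dual_space_iff[OF X]
      by (intro conjI exI[of _ "B + C"]) (auto simp: algebra_simps)
    show "\<Psi> (\<lambda>x. f x + g x) = \<Psi> f + \<Psi> g"
    proof (rule coord_eqI)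
      fix c
      have "J (\<lambda>x. f x + g x) c = J f c + J g c"
        by (rule blinfun_eqI) (simp add: J f g fg plus_blinfun.rep_eq distrib_left coord_add)
      then show "coord (c * \<Psi> (\<lambda>x. f x + g x)) = coord (c * (\<Psi> f + \<Psi> g))"
        by (simp add: \<Psi> f g fg linear_add[OF lin] distrib_left coord_add flip: \<Psi>)
    qed
  next
    fix d f assume f: "f \<in> dual_space sX"
    obtain B where "\<And>x. norm (f x) \<le> B * norm x"
      using f by (auto simp: dual_space_iff[OF X])
    then have "norm (d * f x) \<le> (norm d * B) * norm x" for x
      using mult_left_mono[of "norm (f x)" "B * norm x" "norm d"] by (simp add: norm_mult mult.assoc)
    then have df: "(\<lambda>x. d * f x) \<in> dual_space sX"
      using f unfolding dual_space_iff[OF X]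
      by (intro conjI exI[of _ "norm d * B"]) (auto simp: algebra_simps)
    show "\<Psi> (\<lambda>x. d * f x) = d * \<Psi> f"
    proof (rule coord_eqI)
      fix c
      have "J (\<lambda>x. d * f x) c = J f (c * d)"
        by (rule blinfun_eqI) (simp add: J f df mult.assoc)
      then show "coord (c * \<Psi> (\<lambda>x. d * f x)) = coord (c * (d * \<Psi> f))"
        using \<Psi>[OF df, of c] \<Psi>[OF f, of "c * d"] by (simp add: mult.assoc)
    qed
  next
    \<comment> \<open>The bound on the lift is the product of a bound for \<open>\<Phi>\<close> and
      a bound for \<open>coord\<close>.\<close>
    obtain B where B: "B \<ge> 0" "\<And>r. norm (\<Phi> r) \<le> norm r * B"
      using bounded_linear.nonneg_bounded[OF \<Phi>] by auto
    obtain C where C: "C \<ge> 0" "\<And>a :: 'k. norm (coord a) \<le> norm a * C"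
      using bounded_linear.nonneg_bounded[OF bounded_linear_coord] by auto
    show "\<exists>M. \<forall>f\<in>dual_space sX. norm (\<Psi> f) \<le> M * onorm f"
    proof (intro exI ballI)
      fix f assume f: "f \<in> dual_space sX"
      note bl = dual_space_bounded_linear[OF X f]
      show "norm (\<Psi> f) \<le> (B * C) * onorm f"
      proof (rule norm_le_if_coord_le)
        fix c
        have "norm (J f c) \<le> norm c * onorm f * C"
        proof (rule norm_blinfun_bound)
          show "0 \<le> norm c * onorm f * C"
            using C(1) onorm_pos_le[OF bl] by simp
          fix x
          have "norm (blinfun_apply (J f c) x) \<le> norm (c * f x) * C"
            unfolding J[OF f] by (rule C(2))
          also have "\<dots> \<le> (norm c * (onorm f * norm x)) * C"
            unfolding norm_mult
            by (intro mult_right_mono mult_left_mono onorm[OF bl] C(1) norm_ge_zero)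
          finally show "norm (blinfun_apply (J f c) x) \<le> norm c * onorm f * C * norm x"
            by (simp add: mult_ac)
        qed
        then have "norm (J f c) * B \<le> norm c * onorm f * C * B"
          by (rule mult_right_mono[OF _ B(1)])
        moreover have "coord (c * \<Psi> f) \<le> norm (J f c) * B"
          using B(2)[of "J f c"] \<Psi>[OF f, of c] by simp
        ultimately show "coord (c * \<Psi> f) \<le> B * C * onorm f * norm c"
          by (simp add: mult_ac)
      qed
    qed
  qed
  then obtain x where x: "\<And>f. f \<in> dual_space sX \<Longrightarrow> \<Psi> f = f x"
    using refl unfolding reflexive_space_def by blast
  have "\<Phi> r = blinfun_apply r x" for r
  proof -
    obtain f where f: "f \<in> dual_space sX" "\<And>x. blinfun_apply r x = coord (f x)"
      using real_functional_is_coord[OF X blinfun.bounded_linear_right[of r]] by blast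
    have "J f 1 = r"
      by (rule blinfun_eqI) (simp add: J f)
    then show ?thesis
      using \<Psi>[OF f(1), of 1] x[OF f(1)] f(2) by simp
  qed
  then show ?thesis by blast
qed

section \<open>Minimum modulus\<close>

lemma min_modulus_mult_norm_le:
  assumes T: "bounded_linear T"
  shows "min_modulus T * norm x \<le> norm (T x)"
proof (cases "x = 0")
  case False
  have "min_modulus T \<le> norm (T (x /\<^sub>R norm x))"
    unfolding min_modulus_def
    by (rule cINF_lower) (use False in \<open>auto intro!: bdd_belowI2[where m = 0]\<close>)
  then show ?thesis
    using False by (simp add: linear_scale[OF bounded_linear.linear[OF T]] field_simps)
qed simp

lemma attains_min_modulusI:
  assumes T: "bounded_linear T" and x: "x \<noteq> 0" "norm (T x) \<le> min_modulus T * norm x"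
  shows "attains_min_modulus T"
  unfolding attains_min_modulus_def
proof
  have "norm (T x) = min_modulus T * norm x"
    using x(2) min_modulus_mult_norm_le[OF T, of x] by simp
  then show "norm (T (x /\<^sub>R norm x)) = min_modulus T"
    using x(1) by (simp add: linear_scale[OF bounded_linear.linear[OF T]])
qed (use x in simp)

text \<open>The nonzero vector guarantees a nonempty unit sphere; over the empty set the infimum
  would be an unspecified value.\<close>

lemma min_modulus_scaleR:
  assumes T: "bounded_linear T" and c: "c > 0" and x: "x \<noteq> (0::'a::real_normed_vector)"
  shows "min_modulus (\<lambda>y. c *\<^sub>R T y) \<ge> c * min_modulus (T :: 'a \<Rightarrow> 'b::real_normed_vector)"
  unfolding min_modulus_def[of "\<lambda>y. c *\<^sub>R T y"]
proof (rule cINF_greatest)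
  have "x /\<^sub>R norm x \<in> sphere 0 1" using x by simp
  then show "sphere (0::'a) 1 \<noteq> {}" by blast
  show "c * min_modulus T \<le> norm (c *\<^sub>R T y)" if "y \<in> sphere 0 1" for y
    using min_modulus_mult_norm_le[OF T, of y] that c by simp
qed

text \<open>Weak lower semicontinuity of the norm: test the convergence with a functional norming
  the limit \<open>l\<close>.\<close>

lemma weak_limit_norm_le:
  fixes l :: "'a::real_normed_vector"
  assumes weak: "\<And>r :: 'a \<Rightarrow> real. bounded_linear r \<Longrightarrow> (\<lambda>n. r (u n)) \<longlonglongrightarrow> r l"
    and lim: "(\<lambda>n. norm (u n)) \<longlonglongrightarrow> c"
  shows "norm l \<le> c"
proof -
  obtain f :: "'a \<Rightarrow> real" where f: "bounded_linear f" "\<And>x. \<bar>f x\<bar> \<le> norm x" "f l = norm l"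
    using norming_functional[of l] by blast
  have "(\<lambda>n. f (u n)) \<longlonglongrightarrow> norm l"
    using weak[OF f(1)] by (simp add: f(3))
  then show ?thesis
    by (rule LIMSEQ_le[OF _ lim]) (use f(2) abs_le_D1 in blast)
qed

section \<open>From properties (m) and (o) to attainment\<close>

lemma norm_le_of_properties_m_o:
  fixes sX :: "'k::{real_normed_field,euclidean_space} \<Rightarrow> 'a::real_normed_vector \<Rightarrow> 'a"
  assumes m: "operator_property_m sX T" and o: "operator_property_o sX T"
    and null: "weakly_null sX u" and x: "x \<noteq> 0"
    and nx: "\<And>n. norm (x + u n) = c" and ny: "(\<lambda>n. norm (y + T (u n))) \<longlonglongrightarrow> c"
  shows "norm y \<le> norm x"
proof (rule ccontr)
  assume "\<not> norm y \<le> norm x"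
  then have less: "norm x < norm y" by simp
  \<comment> \<open>With this factor \<open>s *\<^sub>R x\<close> has the norm of \<open>y\<close>,
    so property (m) applies to this pair.\<close>
  define s where "s = norm y / norm x"
  have s: "s > 1" using less x by (simp add: s_def)
  have y: "y \<noteq> 0" using less by auto
  have lim: "limsup (\<lambda>n. ereal (norm (y + T (u n)))) = ereal c"
    using ny by (intro lim_imp_Limsup) auto
  have "limsup (\<lambda>n. ereal (norm (u n))) < ereal c"
    using o y null unfolding operator_property_o_def lim[symmetric] by blast
  then obtain a where a: "limsup (\<lambda>n. ereal (norm (u n))) < ereal a" "a < c"
    using ereal_dense2 by force
  \<comment> \<open>Chosen so that \<open>(c + e) + (s - 1) * a\<close> is exactly
    \<open>s * c\<close>.\<close>
  define e where "e = (c - a) * (s - 1)"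
  have e: "e > 0" using a s by (simp add: e_def)
  have "norm (s *\<^sub>R x) \<le> norm y"
    using x s by (simp add: s_def)
  then have "limsup (\<lambda>n. ereal (norm (s *\<^sub>R x + u n))) \<le> ereal c"
    using m null unfolding operator_property_m_def lim[symmetric] by blast
  also have "\<dots> < ereal (c + e)" using e by simp
  finally have "\<forall>\<^sub>F n in sequentially. ereal (norm (s *\<^sub>R x + u n)) < ereal (c + e)"
    by (rule Limsup_lessD)
  moreover have "\<forall>\<^sub>F n in sequentially. ereal (norm (u n)) < ereal a"
    using a(1) by (rule Limsup_lessD)
  ultimately have "\<forall>\<^sub>F n in sequentially. False"
  proof eventually_elim
    case (elim n)
    have "s * c = norm (s *\<^sub>R (x + u n))" using nx s by simp
    also have "\<dots> = norm ((s *\<^sub>R x + u n) + (s - 1) *\<^sub>R u n)"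
      by (simp add: algebra_simps)
    also have "\<dots> \<le> norm (s *\<^sub>R x + u n) + (s - 1) * norm (u n)"
      using norm_triangle_ineq[of "s *\<^sub>R x + u n" "(s - 1) *\<^sub>R u n"] s by simp
    also have "\<dots> < (c + e) + (s - 1) * a"
      using elim s by (intro add_strict_mono) auto
    also have "\<dots> = s * c" by (simp add: e_def algebra_simps)
    finally show False by simp
  qed
  then show False by simp
qed

theorem theorem2p6:
  fixes scaleX :: "'k::{real_normed_field,euclidean_space} \<Rightarrow> 'a::banach \<Rightarrow> 'a"
    and scaleY :: "'k \<Rightarrow> 'b::banach \<Rightarrow> 'b"
  assumes "normed_space_over scaleX"
    and "normed_space_over scaleY"
    and "reflexive_space scaleX"
    and "property_m scaleX scaleY"
    and "property_o scaleX scaleY"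
  shows "weak_minimizing_property scaleX scaleY"
  unfolding weak_minimizing_property_def
proof (intro ballI impI, elim exE conjE)
  fix T u assume T: "T \<in> bounded_operators scaleX scaleY"
    and u: "minimizing_sequence T u" and not_null: "\<not> weakly_null scaleX u"
  note X = assms(1) and Y = assms(2)
  have bl: "bounded_linear T" by (rule bounded_operators_bounded_linear[OF X Y T])
  have norm_u: "norm (u n) = 1" and lim_Tu: "(\<lambda>n. norm (T (u n))) \<longlonglongrightarrow> min_modulus T" for n
    using u by (auto simp: minimizing_sequence_def)
  obtain r :: "'a \<Rightarrow> real" where r: "bounded_linear r" "\<not> (\<lambda>n. r (u n)) \<longlonglongrightarrow> 0"
    using not_null unfolding weakly_null_def weakly_converges_to_iff_real[OF X]
    by (auto simp: linear_0 bounded_linear.linear)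
  \<comment> \<open>Some real functional stays away from 0 along a subsequence, which later forces
    the weak limit to be nonzero.\<close>
  obtain e where e: "e > 0" and "\<exists>\<^sub>F n in sequentially. e \<le> \<bar>r (u n)\<bar>"
    using r(2) unfolding tendsto_iff by (auto simp: not_eventually not_less)
  then have "infinite {n. e \<le> \<bar>r (u n)\<bar>}"
    by (simp add: frequently_cofinite flip: cofinite_eq_sequentially)
  then obtain t :: "nat \<Rightarrow> nat" where t: "strict_mono t" "\<And>n. e \<le> \<bar>r (u (t n))\<bar>"
    using infinite_enumerate[of "{n. e \<le> \<bar>r (u n)\<bar>}"] by auto
  obtain s x where s: "strict_mono s"
    and weak: "\<And>f :: 'a \<Rightarrow> real. bounded_linear f \<Longrightarrow> (\<lambda>n. f (u (t (s n)))) \<longlonglongrightarrow> f x"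
    using weakly_convergent_subsequence[of "\<lambda>n. u (t n)" 1, OF reflexive_space_real[OF X assms(3)]]
      norm_u by (metis order_refl)
  define v where "v n = u (t (s n))" for n
  have norm_v: "norm (v n) = 1" for n by (simp add: v_def norm_u)
  have weak_v: "(\<lambda>n. f (v n)) \<longlonglongrightarrow> f x" if "bounded_linear f" for f :: "'a \<Rightarrow> real"
    using weak[OF that] by (simp add: v_def)
  have lim_Tv: "(\<lambda>n. norm (T (v n))) \<longlonglongrightarrow> min_modulus T"
    using LIMSEQ_subseq_LIMSEQ[OF lim_Tu strict_mono_o[OF t(1) s]] by (simp add: o_def v_def)
  have "e \<le> \<bar>r x\<bar>"
    using t(2) by (intro LIMSEQ_le_const[OF tendsto_rabs[OF weak_v[OF r(1)]]]) (auto simp: v_def)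
  then have x: "x \<noteq> 0"
    using e linear_0[OF bounded_linear.linear[OF r(1)]] by auto
  \<comment> \<open>Composing functionals with \<open>T\<close> shows that \<open>T (v n)\<close>
    converges weakly to \<open>T x\<close>.\<close>
  have "norm (T x) \<le> min_modulus T"
    using lim_Tv bounded_linear_compose[OF _ bl] weak_v
    by (intro weak_limit_norm_le[of "\<lambda>n. T (v n)"]) blast+
  have "min_modulus T \<ge> 0"
    using lim_Tv by (rule LIMSEQ_le_const) auto
  then consider "min_modulus T = 0" | "min_modulus T > 0" by linarith
  then show "attains_min_modulus T"
  proof cases
    \<comment> \<open>Here \<open>T x = 0\<close>, so the nonzero vector \<open>x\<close>, once
      normalised, attains the minimum modulus.\<close>
    case 1
    with \<open>norm (T x) \<le> min_modulus T\<close> show ?thesis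
      by (intro attains_min_modulusI[OF bl x]) simp
  next
    case 2
    \<comment> \<open>Rescaling brings the minimum modulus up to 1, as properties (m) and (o)
      demand.\<close>
    define c where "c = 1 / min_modulus T"
    define S where "S y = c *\<^sub>R T y" for y
    have c: "c > 0" "c * min_modulus T = 1" using 2 by (auto simp: c_def)
    have linS: "linear S"
      unfolding S_def by (intro bounded_linear.linear bounded_linear_const_scaleR bl)
    have "min_modulus S \<ge> 1"
      using min_modulus_scaleR[OF bl c(1) x] c(2) by (simp add: S_def[abs_def])
    moreover have "S \<in> bounded_operators scaleX scaleY"
    proof -
      interpret Y: normed_space_over scaleY by (rule Y)
      have T': "\<And>y z. T (y + z) = T y + T z" "\<And>a y. T (scaleX a y) = scaleY a (T y)"
        using T by (auto simp: bounded_operators_iff[OF X Y])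
      obtain B where B: "\<And>y. norm (T y) \<le> B * norm y"
        using T by (auto simp: bounded_operators_iff[OF X Y])
      \<comment> \<open>The real factor \<open>c\<close> acts as the scalar
        \<open>of_real c\<close>, which commutes with \<open>a\<close> in the field.\<close>
      have "S (scaleX a y) = scaleY a (S y)" for a y
        by (simp add: S_def T' mult.commute flip: Y.scale_of_real)
      moreover have "norm (S y) \<le> (c * B) * norm y" for y
        using mult_left_mono[OF B[of y], of c] c(1) by (simp add: S_def mult.assoc)
      ultimately show ?thesis
        using linear_add[OF linS] unfolding bounded_operators_iff[OF X Y] by blast
    qed
    ultimately have "operator_property_m scaleX S" "operator_property_o scaleX S"
      using assms(4,5) by (auto simp: property_m_def property_o_def)
    moreover have "weakly_null scaleX (\<lambda>n. v n - x)"
      unfolding weakly_null_def weakly_converges_to_iff_real[OF X]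
    proof (intro allI impI)
      fix f :: "'a \<Rightarrow> real" assume f: "bounded_linear f"
      show "(\<lambda>n. f (v n - x)) \<longlonglongrightarrow> f 0"
        using tendsto_diff[OF weak_v[OF f] tendsto_const[of "f x"]]
        by (simp add: linear_diff linear_0 bounded_linear.linear[OF f])
    qed
    \<comment> \<open>The sum is \<open>S (v n)\<close>, whose norm is
      \<open>c * norm (T (v n))\<close> and tends to \<open>c * min_modulus T = 1\<close>.\<close>
    moreover have "(\<lambda>n. norm (S x + S (v n - x))) \<longlonglongrightarrow> 1"
      using tendsto_mult_left[OF lim_Tv, of c] c by (simp add: S_def linear_diff[OF linS, unfolded S_def])
    ultimately have "norm (S x) \<le> norm x"
      using x norm_v by (intro norm_le_of_properties_m_o[where u = "\<lambda>n. v n - x" and c = 1]) auto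
    then have "norm (T x) \<le> min_modulus T * norm x"
      using 2 by (simp add: S_def c_def field_simps)
    then show ?thesis by (rule attains_min_modulusI[OF bl x])
  qed
qed

end
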